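(* Let $f\colon\{0,1\}^n\to\{0,1,\perp\}$ be a partial function, $F(x,y)=f(x\oplus y)$, and let $h\colon\{0,1\}^n\to\{0,1\}^t$ be a total function. There exists a total function $\varphi\colon\{0,1\}^t\times\{0,1\}^n\to\{0,1\}$ such that $\varphi(h(x),y)=F(x,y)$ for all $(x,y)\in\operatorname{Dom}(F)$ if and only if $f$ takes the same value on all vertices of each connected component of the partial $h$-induced graph.
   Context: $\operatorname{Dom}(f)=f^{-1}(\{0,1\})$, $\oplus$ is bitwise XOR, $\operatorname{Dom}(F)=\{(x,y):x\oplus y\in\operatorname{Dom}(f)\}$. A vector $\Delta\in\{0,1\}^n$ is a good shift for $h$ if there exist $x,y\in\{0,1\}^n$ with $x\oplus y=\Delta$ and $h(x)=h(y)$. The total $h$-induced graph has vertex set $\{0,1\}^n$ and an edge between distinct $x,y$ iff $x\oplus y$ is a good shift for $h$. The partial $h$-induced graph is the subgraph of the total $h$-induced graph induced on the vertex set $\operatorname{Dom}(f)$. *)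

theory Defs
  imports "Graph_Theory.Digraph_Component" "HOL-Library.FuncSet"
begin

text \<open>
  Bit strings are boolean lists, so that every length (including \<open>0\<close>) is covered. A partial
  function on \<open>{0,1}\<^sup>n\<close> has type \<open>bool list \<Rightarrow> bool option\<close>, with \<open>None\<close> for the undefined value;
  its values on lists of length other than \<open>n\<close> are never consulted.
\<close>

definition bits :: "nat \<Rightarrow> bool list set" where
  "bits n = {x. length x = n}"

definition bxor :: "bool list \<Rightarrow> bool list \<Rightarrow> bool list" (infixl \<open>\<oplus>\<close> 65) where
  "x \<oplus> y = map2 (\<noteq>) x y"

definition Dom :: "nat \<Rightarrow> (bool list \<Rightarrow> bool option) \<Rightarrow> bool list set" where
  "Dom n f = {x \<in> bits n. f x \<noteq> None}"

definition xor_fun :: "(bool list \<Rightarrow> bool option) \<Rightarrow> bool list \<times> bool list \<Rightarrow> bool option" where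
  "xor_fun f = (\<lambda>(x, y). f (x \<oplus> y))"

definition Dom_xor :: "nat \<Rightarrow> (bool list \<Rightarrow> bool option) \<Rightarrow> (bool list \<times> bool list) set" where
  "Dom_xor n f = {(x, y). x \<in> bits n \<and> y \<in> bits n \<and> x \<oplus> y \<in> Dom n f}"

definition good_shift :: "nat \<Rightarrow> (bool list \<Rightarrow> bool list) \<Rightarrow> bool list \<Rightarrow> bool" where
  "good_shift n h \<Delta> \<longleftrightarrow>
     \<Delta> \<in> bits n \<and> (\<exists>x \<in> bits n. \<exists>y \<in> bits n. x \<oplus> y = \<Delta> \<and> h x = h y)"

text \<open>An undirected edge is represented by the two opposite arcs between its endpoints.\<close>

definition total_graph ::
    "nat \<Rightarrow> (bool list \<Rightarrow> bool list) \<Rightarrow> (bool list, bool list \<times> bool list) pre_digraph" where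
  "total_graph n h =
     \<lparr> verts = bits n,
       arcs = {(x, y). x \<in> bits n \<and> y \<in> bits n \<and> x \<noteq> y \<and> good_shift n h (x \<oplus> y)},
       tail = fst, head = snd \<rparr>"

definition partial_graph ::
    "nat \<Rightarrow> (bool list \<Rightarrow> bool option) \<Rightarrow> (bool list \<Rightarrow> bool list) \<Rightarrow>
     (bool list, bool list \<times> bool list) pre_digraph" where
  "partial_graph n f h = total_graph n h \<restriction> Dom n f"

definition connected_components :: "('a, 'b) pre_digraph \<Rightarrow> ('a, 'b) pre_digraph set" where
  "connected_components G = {H. pre_digraph.max_subgraph G Digraph_Component.connected H}"

lemma bxor_commute: "x \<oplus> y = y \<oplus> x"
  unfolding bxor_def by (subst zip_commute) (auto simp: case_prod_beta)

lemma wf_digraph_partial_graph: "wf_digraph (partial_graph n f h)"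
  by (auto simp: wf_digraph_def partial_graph_def total_graph_def induce_subgraph_def)

lemma symmetric_partial_graph: "symmetric (partial_graph n f h)"
  by (auto simp: symmetric_def sym_def arcs_ends_def arc_to_ends_def partial_graph_def
      total_graph_def induce_subgraph_def bxor_commute image_iff)

end

theory Submission
  imports Defs
begin

text \<open>
  If \<open>\<phi>\<close> exists and \<open>u \<oplus> v = a \<oplus> b\<close> with \<open>h a = h b\<close>, then for \<open>y = a \<oplus> u\<close> we have \<open>a \<oplus> y = u\<close>
  and \<open>b \<oplus> y = v\<close>, so \<open>f u = \<phi> (h a, y) = \<phi> (h b, y) = f v\<close>: the function \<open>f\<close> agrees on adjacent
  vertices, hence on components. Conversely, if \<open>h x = h x'\<close> then \<open>x \<oplus> y\<close> and \<open>x' \<oplus> y\<close> differ by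
  the good shift \<open>x \<oplus> x'\<close>, so \<open>f (x \<oplus> y)\<close> depends only on \<open>h x\<close> and \<open>y\<close>.
\<close>

lemma bxor_in_bits: "x \<in> bits n \<Longrightarrow> y \<in> bits n \<Longrightarrow> x \<oplus> y \<in> bits n"
  by (simp add: bits_def bxor_def)

lemma bxor_cancel_left:
  assumes "x \<in> bits n" "y \<in> bits n"
  shows "x \<oplus> (x \<oplus> y) = y"
  using assms by (auto simp: bits_def bxor_def intro!: nth_equalityI)

lemma bxor_cancel_right:
  assumes "x \<in> bits n" "y \<in> bits n" "z \<in> bits n"
  shows "(x \<oplus> z) \<oplus> (y \<oplus> z) = x \<oplus> y"
  using assms by (auto simp: bits_def bxor_def intro!: nth_equalityI)

text \<open>Regrouping the XOR turns the left side into \<open>u \<oplus> (u \<oplus> v)\<close>,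
  where \<open>u\<close> cancels.\<close>

lemma bxor_eq_imp_bxor_bxor_eq:
  assumes "u \<in> bits n" "v \<in> bits n" "a \<in> bits n" "b \<in> bits n" and "a \<oplus> b = u \<oplus> v"
  shows "b \<oplus> (a \<oplus> u) = v"
proof -
  have "b \<oplus> (a \<oplus> u) = u \<oplus> (a \<oplus> b)"
    using assms(1-4) by (auto simp: bits_def bxor_def intro!: nth_equalityI)
  then show ?thesis
    using assms by (simp add: bxor_cancel_left)
qed

lemma finite_bits: "finite (bits n)"
  using finite_lists_length_eq[of "UNIV :: bool set" n] by (simp add: bits_def)

lemma adjacent_partial_graph_iff:
  "u \<rightarrow>\<^bsub>partial_graph n f h\<^esub> v \<longleftrightarrow>
     u \<in> Dom n f \<and> v \<in> Dom n f \<and> u \<noteq> v \<and> good_shift n h (u \<oplus> v)"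
  by (auto simp: arcs_ends_conv partial_graph_def total_graph_def induce_subgraph_def Dom_def
      image_iff)

lemma sym_digraph_partial_graph: "sym_digraph (partial_graph n f h)"
proof -
  interpret wf_digraph "partial_graph n f h" by (rule wf_digraph_partial_graph)
  have "finite (Dom n f)" "finite (bits n \<times> bits n)"
    using finite_bits by (auto simp: Dom_def)
  then show ?thesis
    by unfold_locales
      (simp add: symmetric_partial_graph |
        auto simp: partial_graph_def total_graph_def induce_subgraph_def arc_to_ends_def
          intro: finite_subset[of _ "bits n \<times> bits n"])+
qed

text \<open>Connectedness means strong connectedness of the symmetric closure. A subgraph of a
  symmetric graph may keep only one arc of an opposite pair, so the walk is taken in the closure of
  \<open>H\<close>, moved to the closure of \<open>G\<close>, and brought back to \<open>G\<close>
  by symmetry.\<close>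

lemma (in wf_digraph) connected_subgraph_imp_reachable:
  assumes "symmetric G" "subgraph H G" "Digraph_Component.connected H" "u \<in> verts H" "v \<in> verts H"
  shows "u \<rightarrow>\<^sup>* v"
proof -
  have "u \<rightarrow>\<^sup>*\<^bsub>mk_symmetric H\<^esub> v"
    using assms by (auto simp: connected_def strongly_connected_def)
  then have "u \<rightarrow>\<^sup>*\<^bsub>mk_symmetric G\<^esub> v"
    using subgraph_mk_symmetric[OF \<open>subgraph H G\<close>] by (rule pre_digraph.reachable_mono)
  then show ?thesis
    using reachable_mk_symmetric_eq[OF \<open>symmetric G\<close>] by simp
qed

text \<open>Supplies a component containing a given vertex: its strong component, which is also
  maximal among connected subgraphs.\<close>

lemma (in sym_digraph) induce_reachable_in_connected_components:
  assumes "u \<in> verts G"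
  shows "G \<restriction> {v. u \<rightarrow>\<^sup>* v} \<in> connected_components G"
proof -
  let ?C = "G \<restriction> {v. u \<rightarrow>\<^sup>* v}"
  have "?C \<in> sccs"
    using assms by (rule induce_reachable_is_in_sccs)
  then have sub: "subgraph ?C G" and sc: "strongly_connected ?C"
    by (auto simp: sccs_altdef2 max_subgraph_def)
  interpret C: wf_digraph ?C using sub by blast
  have "Digraph_Component.connected ?C"
    using sc by (auto simp: connected_def strongly_connected_def intro: C.reachable_mk_symmetricI)
  \<comment> \<open>Maximality has to be shown against all connected \<open>H\<close>, not only
    strongly connected ones. Such an \<open>H\<close> contains \<open>u\<close>, so each of its
    vertices is reachable from \<open>u\<close>.\<close>
  moreover have "H = ?C"
    if "subgraph ?C H" "subgraph H G" "Digraph_Component.connected H" for H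
  proof -
    have "u \<in> verts H"
      using that(1) assms by (auto simp: subgraph_def)
    then have "verts H \<subseteq> {v. u \<rightarrow>\<^sup>* v}"
      using connected_subgraph_imp_reachable[OF sym_arcs that(2,3)] by blast
    then have "subgraph H ?C"
      using that(2) by (auto simp: subgraph_def compatible_def wf_digraph_def induce_subgraph_def)
    then show ?thesis
      using that(1) by (auto simp: subgraph_def compatible_def intro!: pre_digraph.equality)
  qed
  ultimately show ?thesis
    using sub unfolding connected_components_def by (auto simp: max_subgraph_def)
qed

text \<open>Adjacent vertices share a component; conversely, vertices of one component are joined by
  a walk, along which equality of \<open>g\<close> propagates arc by arc.\<close>

lemma (in sym_digraph) constant_on_connected_components_iff:
  "(\<forall>C \<in> connected_components G. \<forall>u \<in> verts C. \<forall>v \<in> verts C. g u = g v) \<longleftrightarrow>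
     (\<forall>u v. u \<rightarrow>\<^bsub>G\<^esub> v \<longrightarrow> g u = g v)" (is "?L \<longleftrightarrow> ?R")
proof
  assume ?L
  show ?R
  proof (intro allI impI)
    fix u v assume "u \<rightarrow>\<^bsub>G\<^esub> v"
    then have "u \<in> verts G" "v \<in> verts G" "u \<rightarrow>\<^sup>* v"
      by (auto simp: adj_in_verts)
    then have "G \<restriction> {w. u \<rightarrow>\<^sup>* w} \<in> connected_components G"
      and "u \<in> verts (G \<restriction> {w. u \<rightarrow>\<^sup>* w})" "v \<in> verts (G \<restriction> {w. u \<rightarrow>\<^sup>* w})"
      by (simp_all add: induce_reachable_in_connected_components)
    with \<open>?L\<close> show "g u = g v"
      by blast
  qed
next
  assume R: ?R
  show ?L
  proof (intro ballI)
    fix C u v assume "C \<in> connected_components G" "u \<in> verts C" "v \<in> verts C"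
    then have "u \<rightarrow>\<^sup>* v"
      by (intro connected_subgraph_imp_reachable[OF sym_arcs, of C])
        (auto simp: connected_components_def max_subgraph_def)
    then show "g u = g v"
      by (induction rule: reachable_induct) (use R in auto)
  qed
qed

theorem theorem16:
  fixes n t :: nat
    and f :: "bool list \<Rightarrow> bool option"
    and h :: "bool list \<Rightarrow> bool list"
  assumes "h \<in> bits n \<rightarrow> bits t"
  shows "(\<exists>\<phi> :: bool list \<times> bool list \<Rightarrow> bool.
            \<forall>(x, y) \<in> Dom_xor n f. Some (\<phi> (h x, y)) = xor_fun f (x, y))
    \<longleftrightarrow> (\<forall>C \<in> connected_components (partial_graph n f h).
            \<forall>u \<in> verts C. \<forall>v \<in> verts C. f u = f v)"
    (is "?L \<longleftrightarrow> ?R")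
proof -
  interpret sym_digraph "partial_graph n f h" by (rule sym_digraph_partial_graph)
  have R_iff: "?R \<longleftrightarrow> (\<forall>u v. u \<rightarrow>\<^bsub>partial_graph n f h\<^esub> v \<longrightarrow> f u = f v)"
    by (rule constant_on_connected_components_iff)
  show ?thesis
    unfolding R_iff
  proof
    assume ?L
    then obtain \<phi> where \<phi>: "Some (\<phi> (h x, y)) = f (x \<oplus> y)"
      if "x \<in> bits n" "y \<in> bits n" "x \<oplus> y \<in> Dom n f" for x y
      by (auto simp: Dom_xor_def xor_fun_def)
    show "\<forall>u v. u \<rightarrow>\<^bsub>partial_graph n f h\<^esub> v \<longrightarrow> f u = f v"
    proof (intro allI impI)
      fix u v assume "u \<rightarrow>\<^bsub>partial_graph n f h\<^esub> v"
      then obtain a b where uv: "u \<in> Dom n f" "v \<in> Dom n f"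
        and ab: "a \<in> bits n" "b \<in> bits n" "a \<oplus> b = u \<oplus> v" "h a = h b"
        by (auto simp: adjacent_partial_graph_iff good_shift_def)
      then have bits: "u \<in> bits n" "v \<in> bits n"
        by (auto simp: Dom_def)
      have "a \<oplus> (a \<oplus> u) = u" "b \<oplus> (a \<oplus> u) = v"
        using bits ab by (auto intro: bxor_cancel_left bxor_eq_imp_bxor_bxor_eq)
      then show "f u = f v"
        using \<phi>[of a "a \<oplus> u"] \<phi>[of b "a \<oplus> u"] uv ab bits by (simp add: bxor_in_bits)
    qed
  next
    assume adj: "\<forall>u v. u \<rightarrow>\<^bsub>partial_graph n f h\<^esub> v \<longrightarrow> f u = f v"
    \<comment> \<open>The domain condition matters: other preimages of \<open>c\<close> under
      \<open>h\<close> may lead to points where \<open>f\<close> is undefined.\<close>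
    define P where "P c y x \<longleftrightarrow> x \<in> bits n \<and> h x = c \<and> x \<oplus> y \<in> Dom n f" for c y x
    \<comment> \<open>If no \<open>x\<close> satisfies \<open>P c y\<close>, the value is arbitrary,
      and no constraint concerns the pair \<open>(c, y)\<close>.\<close>
    define \<phi> where "\<phi> = (\<lambda>(c, y). the (f ((SOME x. P c y x) \<oplus> y)))"
    have "Some (\<phi> (h x, y)) = f (x \<oplus> y)"
      if "x \<in> bits n" "y \<in> bits n" "x \<oplus> y \<in> Dom n f" for x y
    proof -
      define x' where "x' = (SOME x'. P (h x) y x')"
      have "P (h x) y x"
        using that by (simp add: P_def)
      then have "P (h x) y x'"
        unfolding x'_def by (rule someI)
      then have x': "x' \<in> bits n" "h x' = h x" "x' \<oplus> y \<in> Dom n f"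
        by (auto simp: P_def)
      then have "good_shift n h ((x' \<oplus> y) \<oplus> (x \<oplus> y))"
        using that by (auto simp: bxor_cancel_right good_shift_def bxor_in_bits)
      then have "f (x' \<oplus> y) = f (x \<oplus> y)"
        \<comment> \<open>The graph has no loops, so adjacency applies only to distinct strings;
          equal ones are treated separately.\<close>
        using adj that x' by (cases "x' \<oplus> y = x \<oplus> y") (auto simp: adjacent_partial_graph_iff)
      then show ?thesis
        using that by (auto simp: \<phi>_def x'_def Dom_def)
    qed
    then show ?L
      by (auto simp: Dom_xor_def xor_fun_def intro!: exI[of _ \<phi>])
  qed
qed

end
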